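(* Let $0$ be a point of $\mathbb U$ and let $B(0,1]=\{z\in\mathbb U\colon d(0,z)\le 1\}$. If $\varphi\colon \mathbb U\to\mathbb U$ is an isometric map such that $\varphi(z)=z$ for all $z\in B(0,1]$, then $\varphi=\mathrm{id}_{\mathbb U}$.
   Context: $\mathbb U$ (with distance $d$) denotes the Urysohn space: the unique (up to isometry) nonempty complete separable metric space that is finitely injective, i.e. for any finite metric spaces $K\subseteq L$ and any isometric embedding $\varphi\colon K\to\mathbb U$ there is an isometric embedding $\tilde\varphi\colon L\to\mathbb U$ extending $\varphi$. An isometric map is a distance-preserving map, not necessarily onto. The symbol $0$ denotes an arbitrary point of $\mathbb U$. *)

theory Defs
  imports "HOL-Analysis.Analysis"
begin

text \<open>Distance preserving, not necessarily onto. Functions are only constrained on the carrier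
  \<open>A\<close>.\<close>

definition isometric_map ::
  "'a set \<Rightarrow> ('a \<Rightarrow> 'a \<Rightarrow> real) \<Rightarrow> 'b set \<Rightarrow> ('b \<Rightarrow> 'b \<Rightarrow> real) \<Rightarrow> ('a \<Rightarrow> 'b) \<Rightarrow> bool" where
  "isometric_map A dA B dB f \<longleftrightarrow>
     f \<in> A \<rightarrow> B \<and> (\<forall>x\<in>A. \<forall>y\<in>A. dB (f x) (f y) = dA x y)"

text \<open>HOL definitions cannot quantify over types, so the finite metric spaces are carried by sets of
  natural numbers. As every finite set injects into the naturals, this loses nothing; see
  \<open>finitely_injective_extend\<close> below.\<close>

definition finitely_injective :: "'a set \<Rightarrow> ('a \<Rightarrow> 'a \<Rightarrow> real) \<Rightarrow> bool" where
  "finitely_injective M d \<longleftrightarrow>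
     (\<forall>(L :: nat set) dL K f.
        finite L \<and> Metric_space L dL \<and> K \<subseteq> L \<and> isometric_map K dL M d f \<longrightarrow>
        (\<exists>g. isometric_map L dL M d g \<and> (\<forall>x\<in>K. g x = f x)))"

locale urysohn_space = Metric_space M d
  for M :: "'a set" and d :: "'a \<Rightarrow> 'a \<Rightarrow> real" +
  assumes nonempty: "M \<noteq> {}"
    and complete: "mcomplete"
    and separable: "separable_space mtopology"
    and finite_injectivity: "finitely_injective M d"

lemma finitely_injective_extend:
  fixes L :: "'b set"
  assumes M: "finitely_injective M d"
    and L: "finite L" "Metric_space L dL" "K \<subseteq> L"
    and f: "isometric_map K dL M d f"
  shows "\<exists>g. isometric_map L dL M d g \<and> (\<forall>x\<in>K. g x = f x)"
proof -
  obtain e :: "'b \<Rightarrow> nat" where e: "inj_on e L"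
    using finite_imp_inj_to_nat_seg[OF L(1)] by blast
  define h where "h = inv_into L e"
  have he [simp]: "h (e x) = x" if "x \<in> L" for x
    using e that by (simp add: h_def)
  interpret L: Metric_space L dL by fact
  define dL' where "dL' = (\<lambda>i j. dL (h i) (h j))"
  have "Metric_space (e ` L) dL'"
    by unfold_locales (auto simp: dL'_def L.commute L.triangle)
  moreover have "isometric_map (e ` K) dL' M d (f \<circ> h)"
    using f L(3) by (auto simp: isometric_map_def dL'_def subset_iff Pi_iff)
  moreover have "finite (e ` L)" "e ` K \<subseteq> e ` L"
    using L(1,3) by auto
  ultimately obtain g where g: "isometric_map (e ` L) dL' M d g" "\<forall>i\<in>e ` K. g i = (f \<circ> h) i"
    using M[unfolded finitely_injective_def, rule_format, of "e ` L" dL' "e ` K" "f \<circ> h"] by auto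
  have "isometric_map L dL M d (g \<circ> e)"
    using g(1) by (auto simp: isometric_map_def dL'_def)
  moreover have "\<forall>x\<in>K. (g \<circ> e) x = f x"
    using g(2) L(3) by auto
  ultimately show ?thesis by blast
qed

end

theory Submission
  imports Defs
begin

text \<open>The image \<open>\<phi> x\<close> has the same distances as \<open>x\<close> to all points of the unit ball, so it suffices
  that these distances separate the points of the Urysohn space. Two distinct points \<open>x\<close>, \<open>y\<close> at
  the same distance \<open>r\<close> from the centre are told apart by a point of the unit sphere whose distances
  to \<open>x\<close> and \<open>y\<close> are \<open>r + 1\<close> and \<open>r + 1 - min (d x y) 1\<close>: these values are compatible with
  the triangle inequalities, so finite injectivity provides such a point.\<close>

text \<open>Conditions \<open>lip\<close> and \<open>tri\<close> say exactly that adjoining one new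
  point to \<open>F\<close> at distances \<open>h\<close> satisfies the triangle inequality. Finite
  injectivity then realises the new point in \<open>M\<close> while keeping \<open>F\<close>
  fixed.\<close>

lemma (in Metric_space) one_point_extension:
  assumes inj: "finitely_injective M d"
    and F: "finite F" "F \<subseteq> M"
    and pos: "\<And>a. a \<in> F \<Longrightarrow> 0 < h a"
    and lip: "\<And>a b. \<lbrakk>a \<in> F; b \<in> F\<rbrakk> \<Longrightarrow> h a \<le> h b + d a b"
    and tri: "\<And>a b. \<lbrakk>a \<in> F; b \<in> F\<rbrakk> \<Longrightarrow> d a b \<le> h a + h b"
  obtains z where "z \<in> M" "\<And>a. a \<in> F \<Longrightarrow> d z a = h a"
proof -
  \<comment> \<open>\<open>None\<close> is the new point. The absolute values matter only off
    \<open>F\<close>: \<open>Metric_space\<close> demands nonnegativity for all arguments, not just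
    on the carrier.\<close>
  define D where "D = (\<lambda>p q. case p of
      None \<Rightarrow> (case q of None \<Rightarrow> 0 | Some b \<Rightarrow> \<bar>h b\<bar>)
    | Some a \<Rightarrow> (case q of None \<Rightarrow> \<bar>h a\<bar> | Some b \<Rightarrow> d a b))"
  define L where "L = insert None (Some ` F)"
  have h_abs: "\<bar>h a\<bar> = h a" if "a \<in> F" for a
    using pos[OF that] by simp
  have lip': "h b \<le> h a + d a b" "h b \<le> d a b + h a" if "a \<in> F" "b \<in> F" for a b
    using lip[OF that(2,1)] by (simp_all add: commute)
  have metric: "Metric_space L D"
  proof
    show "0 \<le> D p q" for p q
      by (auto simp: D_def split: option.splits)
    show "D p q = D q p" for p q
      by (auto simp: D_def commute split: option.splits)
    show "D p q = 0 \<longleftrightarrow> p = q" if "p \<in> L" "q \<in> L" for p q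
      using that F(2) by (auto simp: D_def L_def subset_iff dest: pos)
    \<comment> \<open>With \<open>None\<close> in the middle this is \<open>tri\<close>; with
      \<open>None\<close> at one end it is \<open>lip\<close>.\<close>
    show "D p s \<le> D p q + D q s" if "p \<in> L" "q \<in> L" "s \<in> L" for p q s
      using that F(2)
      by (auto simp: D_def L_def h_abs subset_iff triangle lip lip' tri less_imp_le[OF pos]
          add.commute)
  qed
  \<comment> \<open>Here \<open>the\<close> is the inclusion of \<open>F\<close> into
    \<open>M\<close>.\<close>
  have "isometric_map (Some ` F) D M d the"
    using F(2) by (auto simp: isometric_map_def D_def)
  then obtain g where g: "isometric_map L D M d g" "\<forall>p\<in>Some ` F. g p = the p"
    using finitely_injective_extend[OF inj _ metric, of "Some ` F" the] F(1)
    by (auto simp: L_def)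
  show thesis
  proof
    show "g None \<in> M"
      using g(1) by (auto simp: isometric_map_def L_def)
    show "d (g None) a = h a" if "a \<in> F" for a
    proof -
      have "d (g None) (g (Some a)) = D None (Some a)"
        using g(1) that by (auto simp: isometric_map_def L_def)
      then show ?thesis
        using g(2) that by (simp add: D_def h_abs)
    qed
  qed
qed

lemma (in Metric_space) unit_ball_separates:
  assumes inj: "finitely_injective M d"
    and M: "c \<in> M" "x \<in> M" "y \<in> M"
    and "x \<noteq> y"
  shows "\<exists>z \<in> mcball c 1. d z x \<noteq> d z y"
proof (cases "d c x = d c y")
  case False
  then show ?thesis
    using M(1) by (intro bexI[of _ c]) auto
next
  case True
  define r where "r = d c x"
  \<comment> \<open>The bound \<open>d x y\<close> keeps \<open>h\<close> 1-Lipschitz between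
    \<open>x\<close> and \<open>y\<close>; the cap 1 keeps \<open>r + 1 - \<epsilon>\<close>
    positive.\<close>
  define \<epsilon> where "\<epsilon> = min (d x y) 1"
  have cx: "d c x = r" "d x c = r" and cy: "d c y = r" "d y c = r"
    using True by (simp_all add: r_def commute)
  \<comment> \<open>The bound \<open>2 * r\<close> gives \<open>\<epsilon> \<le> 2 * r\<close>, so
    that \<open>h c\<close> and \<open>h y\<close> differ by at most \<open>r\<close>.\<close>
  have xy: "0 < d x y" "d x y \<le> 2 * r" "d y x = d x y"
    using M \<open>x \<noteq> y\<close> triangle[of x c y] by (auto simp: cx cy commute)
  have \<epsilon>: "0 < \<epsilon>" "\<epsilon> \<le> d x y" "\<epsilon> \<le> 1"
    using xy(1) by (auto simp: \<epsilon>_def)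
  have "0 < r"
    using xy by linarith
  then have ne: "x \<noteq> c" "y \<noteq> c"
    using M cx cy by auto
  define h where "h = (\<lambda>p. if p = c then 1 else if p = x then r + 1 else r + 1 - \<epsilon>)"
  have h: "h c = 1" "h x = r + 1" "h y = r + 1 - \<epsilon>"
    using ne \<open>x \<noteq> y\<close> by (simp_all add: h_def)
  obtain z where z: "z \<in> M" "\<And>a. a \<in> {c, x, y} \<Longrightarrow> d z a = h a"
  proof (rule one_point_extension[OF inj, of "{c, x, y}" h])
    show "{c, x, y} \<subseteq> M"
      using M by simp
    show "0 < h a" if "a \<in> {c, x, y}" for a
      using that \<epsilon> \<open>0 < r\<close> by (auto simp: h)
    show "h a \<le> h b + d a b" if "a \<in> {c, x, y}" "b \<in> {c, x, y}" for a b
      using that M \<epsilon> xy \<open>0 < r\<close> by (auto simp: h cx cy)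
    show "d a b \<le> h a + h b" if "a \<in> {c, x, y}" "b \<in> {c, x, y}" for a b
      using that M \<epsilon> xy \<open>0 < r\<close> by (auto simp: h cx cy)
  qed auto
  have "z \<in> mcball c 1"
    using z M(1) h(1) by (simp add: commute)
  moreover have "d z x \<noteq> d z y"
    using z(2) h \<epsilon>(1) by simp
  ultimately show ?thesis
    by blast
qed

theorem theorem3p1:
  fixes U :: "'a set" and d :: "'a \<Rightarrow> 'a \<Rightarrow> real" and z0 :: 'a and \<phi> :: "'a \<Rightarrow> 'a"
  assumes "urysohn_space U d"
    and "z0 \<in> U"
    and "isometric_map U d U d \<phi>"
    and "\<forall>z \<in> Metric_space.mcball U d z0 1. \<phi> z = z"
  shows "\<forall>z \<in> U. \<phi> z = z"
proof (intro ballI, rule ccontr)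
  interpret urysohn_space U d by fact
  fix x
  assume x: "x \<in> U" "\<phi> x \<noteq> x"
  have \<phi>: "\<phi> x \<in> U" "\<And>z. z \<in> U \<Longrightarrow> d (\<phi> z) (\<phi> x) = d z x"
    using assms(3) x(1) by (auto simp: isometric_map_def)
  obtain z where z: "z \<in> mcball z0 1" "d z (\<phi> x) \<noteq> d z x"
    using unit_ball_separates[OF finite_injectivity assms(2) \<phi>(1) x] by blast
  then have "\<phi> z = z" "z \<in> U"
    using assms(4) by auto
  then show False
    using \<phi>(2)[of z] z(2) by simp
qed

end
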